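(* Let $T$ be an out-tree (arborescence) with $n$ vertices and $l$ leaves. Then $\chi_{d}(T)=n-l+1$.
   Context: All digraphs are orientations of finite simple trees. An out-tree (arborescence) is an orientation of a tree in which all arcs point away from a single source (the root). A leaf of an out-tree is a vertex of out-degree zero (so the root is not counted as a leaf, even if its degree is one, unless the tree is a single vertex, which is regarded as having one leaf). For a vertex $v$ of a digraph $D$, $N^{+}(v)$ denotes the open out-neighborhood, i.e. the set of vertices $w$ such that $(v,w)$ is an arc; $v$ dominates each vertex of $N^{+}(v)$. A dominator coloring of $D$ is a proper vertex coloring (adjacent vertices of the underlying graph receive different colors) such that every vertex $v$ with $N^{+}(v)\neq\emptyset$ dominates at least one color class, i.e. there is a nonempty color class contained in $N^{+}(v)$ (vertices of out-degree zero are exempt). The dominator chromatic number $\chi_{d}(D)$ is the minimum number of colors in a dominator coloring of $D$. *)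

theory Defs
  imports "Graph_Theory.Digraph_Component"
begin

text \<open>
  The predicate \<open>forest\<close> (hence \<open>tree\<close>) of the library only excludes directed cycles,
  so it cannot be used for a statement about the underlying undirected graph. In
  \<open>mk_symmetric G\<close> every edge traversed back and forth is a \<open>cycle\<close> of length 2; the
  undirected cycles of a simple graph are those of length at least 3.
\<close>

definition undirected_acyclic :: "('a, 'b) pre_digraph \<Rightarrow> bool" where
  "undirected_acyclic G \<longleftrightarrow>
     \<not> (\<exists>p. pre_digraph.cycle (with_proj (mk_symmetric G)) p \<and> length p \<ge> 3)"

text \<open>
  Asymmetry of \<open>arcs_ends\<close>, together with the absence of parallel arcs in \<open>digraph\<close>,
  says that each edge of the underlying graph carries exactly one arc. The empty digraph is
  excluded by \<open>connected\<close>, which refers to the underlying symmetric graph.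
\<close>

definition oriented_tree :: "('a, 'b) pre_digraph \<Rightarrow> bool" where
  "oriented_tree G \<longleftrightarrow>
     digraph G \<and> asym (arcs_ends G) \<and> connected G \<and> undirected_acyclic G"

text \<open>
  The arc from \<open>u\<close> to \<open>v\<close> points away from \<open>r\<close> if the path from \<open>r\<close> to \<open>v\<close> in the
  underlying tree traverses it last, from \<open>u\<close> to \<open>v\<close>.
\<close>

definition points_away_from :: "('a, 'b) pre_digraph \<Rightarrow> 'a \<Rightarrow> 'a \<Rightarrow> 'a \<Rightarrow> bool" where
  "points_away_from G r u v \<longleftrightarrow>
     (\<exists>p. pre_digraph.apath (with_proj (mk_symmetric G)) r (p @ [(u, v)]) v)"

definition out_tree :: "('a, 'b) pre_digraph \<Rightarrow> bool" where
  "out_tree T \<longleftrightarrow> oriented_tree T \<and>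
     (\<exists>r \<in> verts T. in_degree T r = 0 \<and>
        (\<forall>u v. u \<rightarrow>\<^bsub>T\<^esub> v \<longrightarrow> points_away_from T r u v))"

definition leaves :: "('a, 'b) pre_digraph \<Rightarrow> 'a set" where
  "leaves T = {v \<in> verts T. out_degree T v = 0}"

definition out_neighborhood :: "('a, 'b) pre_digraph \<Rightarrow> 'a \<Rightarrow> 'a set" where
  "out_neighborhood G v = {w. v \<rightarrow>\<^bsub>G\<^esub> w}"

definition color_class :: "('a, 'b) pre_digraph \<Rightarrow> ('a \<Rightarrow> 'c) \<Rightarrow> 'c \<Rightarrow> 'a set" where
  "color_class G c k = {v \<in> verts G. c v = k}"

definition proper_coloring :: "('a, 'b) pre_digraph \<Rightarrow> ('a \<Rightarrow> 'c) \<Rightarrow> bool" where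
  "proper_coloring G c \<longleftrightarrow> (\<forall>u v. u \<rightarrow>\<^bsub>G\<^esub> v \<longrightarrow> c u \<noteq> c v)"

definition dominator_coloring :: "('a, 'b) pre_digraph \<Rightarrow> ('a \<Rightarrow> 'c) \<Rightarrow> bool" where
  "dominator_coloring G c \<longleftrightarrow> proper_coloring G c \<and>
     (\<forall>v \<in> verts G. out_neighborhood G v \<noteq> {} \<longrightarrow>
        (\<exists>k. color_class G c k \<noteq> {} \<and> color_class G c k \<subseteq> out_neighborhood G v))"

text \<open>
  Colors are natural numbers, which is no restriction for finite digraphs; only the colors
  actually used are counted.
\<close>

definition dominator_chromatic_number :: "('a, 'b) pre_digraph \<Rightarrow> nat" where
  "dominator_chromatic_number G =
     (LEAST k. \<exists>c :: 'a \<Rightarrow> nat. dominator_coloring G c \<and> card (c ` verts G) = k)"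

text \<open>The minimum above is attained: giving all vertices different colors always works.\<close>

lemma dominator_coloring_exists:
  assumes "digraph G"
  shows "\<exists>c :: 'a \<Rightarrow> nat. dominator_coloring (G :: ('a, 'b) pre_digraph) c"
proof -
  interpret digraph G by fact
  obtain c :: "'a \<Rightarrow> nat" where inj: "inj_on c (verts G)"
    using finite_imp_inj_to_nat_seg[OF finite_verts] by blast
  have in_verts: "u \<in> verts G" "v \<in> verts G" if "u \<rightarrow>\<^bsub>G\<^esub> v" for u v
    using that by (auto simp: arcs_ends_conv)
  have "c u \<noteq> c v" if "u \<rightarrow>\<^bsub>G\<^esub> v" for u v
    using inj_onD[OF inj] in_verts[OF that] that adj_not_same by blast
  moreover have "color_class G c (c w) = {w}" if "w \<in> verts G" for w
    using that inj by (auto simp: color_class_def inj_on_def)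
  then have "\<exists>k. color_class G c k \<noteq> {} \<and> color_class G c k \<subseteq> out_neighborhood G v"
    if "w \<in> out_neighborhood G v" for v w
    using that in_verts(2)[of v w]
    by (intro exI[of _ "c w"]) (simp add: out_neighborhood_def)
  ultimately have "dominator_coloring G c"
    unfolding dominator_coloring_def proper_coloring_def by blast
  then show ?thesis by blast
qed

end

theory Submission
  imports Defs
begin

text \<open>
  In an out-tree the root has no in-neighbor and every other vertex has exactly one, its
  parent. Hence the out-neighborhoods of the \<open>n - l\<close> vertices that are not leaves are nonempty,
  pairwise disjoint, and partition the vertices other than the root. This settles both
  inequalities.

  Lower bound (\<open>card_colors_ge\<close>): the color classes dominated by two different vertices lie in
  disjoint out-neighborhoods, so they are different; and none of them is the class of the root,
  which lies in no out-neighborhood. This makes \<open>n - l + 1\<close> colors.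

  Upper bound (\<open>parent_coloring_exists\<close>): give the root a color of its own and color every other
  vertex by its parent. The color classes are then the out-neighborhoods and the root alone, so
  every parent dominates a class; the coloring is proper because no vertex is its own parent.

  What remains is that parents are unique, for orientations defined by paths in the underlying
  undirected tree (\<open>out_tree_imp_unique_parents\<close>). The tool is
  \<open>distinct_entries_imp_cycle\<close>: two paths with a common start that enter \<open>v\<close> from different
  neighbors create an undirected cycle through \<open>v\<close>. Applied to the paths from the root, it shows
  that the path from the root to \<open>v\<close> has a well-defined last edge, and this edge is the only
  candidate for an arc into \<open>v\<close>.
\<close>

section \<open>Paths that enter a vertex from different neighbors\<close>

text \<open>
  The result is again a pair digraph, so that the theory of symmetric pair digraphs applies to
  \<open>mk_symmetric T\<close> without a vertex.
\<close>

definition delete_vertex :: "'a pair_pre_digraph \<Rightarrow> 'a \<Rightarrow> 'a pair_pre_digraph" where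
  "delete_vertex G v =
     \<lparr> pverts = pverts G - {v}, parcs = {e \<in> parcs G. fst e \<noteq> v \<and> snd e \<noteq> v} \<rparr>"

lemma delete_vertex_simps [simp]:
  "pverts (delete_vertex G v) = pverts G - {v}"
  "parcs (delete_vertex G v) = {e \<in> parcs G. fst e \<noteq> v \<and> snd e \<noteq> v}"
  by (simp_all add: delete_vertex_def)

lemma (in pair_sym_digraph) pair_sym_digraph_delete_vertex:
  "pair_sym_digraph (delete_vertex G v)"
proof
  show "symmetric (with_proj (delete_vertex G v))"
    unfolding symmetric_def by (auto intro!: symI dest: arcs_symmetric)
qed (auto dest: wellformed')

text \<open>A path visits its last vertex only once, so the part before it survives the deletion.\<close>

lemma (in pair_wf_digraph) reachable_delete_vertex:
  assumes "apath r (p @ [(u, v)]) v"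
  shows "r \<rightarrow>\<^sup>*\<^bsub>delete_vertex G v\<^esub> u"
proof -
  have wf: "wf_digraph (with_proj (delete_vertex G v))"
    by unfold_locales (auto dest: arc_fst_in_verts arc_snd_in_verts)
  have walk: "awalk r p u" and "v \<notin> set (pawalk_verts r p)"
    using assms by (auto simp: apath_append_iff apath_simps awalkI_apath)
  moreover have "fst e \<in> set (pawalk_verts r p) \<and> snd e \<in> set (pawalk_verts r p)"
    if "e \<in> set p" for e
    using that set_awalk_verts[OF walk] by auto
  ultimately have "pre_digraph.awalk (with_proj (delete_vertex G v)) r p u"
    using hd_in_awalk_verts(1)[OF walk]
    by (force simp: pre_digraph.awalk_def cas_with_proj_eq)
  then show ?thesis by (rule wf_digraph.reachable_awalkI[OF wf])
qed

text \<open>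
  Both \<open>u\<close> and \<open>u'\<close> can be reached from \<open>r\<close> without passing through \<open>v\<close>; by symmetry, \<open>u'\<close> can
  be reached from \<open>u\<close> in the same way. A path that does so is closed up by \<open>v\<close> to a cycle.
\<close>

lemma (in pair_sym_digraph) distinct_entries_imp_cycle:
  assumes "apath r (p @ [(u, v)]) v" and "apath r (p' @ [(u', v)]) v" and "u \<noteq> u'"
  shows "\<exists>c. cycle c \<and> 3 \<le> length c"
proof -
  interpret H: pair_sym_digraph "delete_vertex G v"
    by (rule pair_sym_digraph_delete_vertex)
  have "u \<rightarrow>\<^sup>*\<^bsub>delete_vertex G v\<^esub> u'"
    using assms(1,2)[THEN reachable_delete_vertex] symmetric_reachable[OF H.sym_arcs]
      H.reachable_trans by blast
  then obtain q where q: "H.apath u q u'"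
    using H.reachable_apath by blast
  then have "q \<noteq> []" using \<open>u \<noteq> u'\<close> by (auto simp: H.apath_simps)
  have "awalk u q u'" "distinct (pawalk_verts u q)"
    using q by (auto simp: H.apath_def H.awalk_def awalk_def)
  moreover have "v \<notin> set (pawalk_verts u q)"
    using q H.awalk_verts_in_verts[of u q u'] H.awalkI_apath by fastforce
  moreover have "(v, u) \<in> parcs G" "(u', v) \<in> parcs G"
    using assms(1,2) by (auto simp: apath_append_iff apath_simps dest: arcs_symmetric)
  ultimately have "cycle ((v, u) # q @ [(u', v)])"
    unfolding cycle_def
    by (intro exI[of _ v]) (auto simp: awalk_simps awalk_verts_append dest: wellformed')
  moreover have "3 \<le> length ((v, u) # q @ [(u', v)])"
    using \<open>q \<noteq> []\<close> by (cases q) auto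
  ultimately show ?thesis by blast
qed

section \<open>Parents in an out-tree\<close>

text \<open>
  The local form of being an out-tree with root \<open>r\<close>, in which paths no longer occur. The coloring
  arguments take place here.
\<close>

locale unique_parents = digraph G for G :: "('a, 'b) pre_digraph" +
  fixes r :: 'a
  assumes root_in_verts: "r \<in> verts G"
    and root_no_parent: "\<not> u \<rightarrow>\<^bsub>G\<^esub> r"
    and ex1_parent: "v \<in> verts G \<Longrightarrow> v \<noteq> r \<Longrightarrow> \<exists>!u. u \<rightarrow>\<^bsub>G\<^esub> v"

text \<open>
  At most one parent: arcs into \<open>v\<close> end paths from the root, which must enter \<open>v\<close> from the same
  neighbor. At least one parent: the edge \<open>{x, v}\<close> that a path from the root traverses last must be
  oriented towards \<open>v\<close>. Otherwise \<open>x\<close> is not the root, and some path from the root enters \<open>x\<close> from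
  \<open>v\<close>, whereas the initial part of the given path avoids \<open>v\<close> and enters \<open>x\<close> from another neighbor.
\<close>

lemma out_tree_imp_unique_parents:
  assumes "out_tree T"
  shows "\<exists>r. unique_parents T r"
proof -
  from assms obtain r where T: "digraph T" "connected T" "undirected_acyclic T"
    and r: "r \<in> verts T" "in_degree T r = 0"
    and away: "\<And>u v. u \<rightarrow>\<^bsub>T\<^esub> v \<Longrightarrow> points_away_from T r u v"
    unfolding out_tree_def oriented_tree_def by blast
  interpret digraph T by fact
  interpret S: pair_sym_digraph "mk_symmetric T"
    using wellformed_mk_symmetric symmetric_mk_symmetric
    by (simp add: pair_sym_digraph_def pair_sym_digraph_axioms_def)
  have entry: "u = u'" if "S.apath r (p @ [(u, v)]) v" "S.apath r (p' @ [(u', v)]) v" for u u' v p p'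
    using S.distinct_entries_imp_cycle[OF that] \<open>undirected_acyclic T\<close>
    unfolding undirected_acyclic_def by blast
  have no_in: "\<not> u \<rightarrow>\<^bsub>T\<^esub> r" for u
    using r(2) finite_in_arcs[of r] by (auto simp: in_degree_def arcs_ends_conv)
  have unique: "u = u'" if "u \<rightarrow>\<^bsub>T\<^esub> v" "u' \<rightarrow>\<^bsub>T\<^esub> v" for u u' v
    using that[THEN away] entry unfolding points_away_from_def by blast
  have "\<exists>u. u \<rightarrow>\<^bsub>T\<^esub> v" if v: "v \<in> verts T" "v \<noteq> r" for v
  proof -
    have "r \<rightarrow>\<^sup>*\<^bsub>mk_symmetric T\<^esub> v"
      using \<open>connected T\<close> r v by (auto simp: connected_def)
    then obtain q where q: "S.apath r q v"
      using S.reachable_apath by blast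
    then have "q \<noteq> []" using v by (auto simp: S.apath_simps)
    then obtain p x y where "q = p @ [(x, y)]"
      by (metis rev_exhaust surj_pair)
    with q have p: "S.apath r (p @ [(x, v)]) v"
      by (auto simp: S.apath_append_iff S.apath_simps)
    then have "(x, v) \<in> parcs (mk_symmetric T)"
      by (auto simp: S.apath_append_iff S.apath_simps)
    then consider "x \<rightarrow>\<^bsub>T\<^esub> v" | "v \<rightarrow>\<^bsub>T\<^esub> x"
      by (auto simp: parcs_mk_symmetric arcs_ends_conv)
    then show ?thesis
    proof cases
      \<comment> \<open>The last edge would point back towards the root.\<close>
      case 2
      then obtain p' where p': "S.apath r (p' @ [(v, x)]) x"
        using away unfolding points_away_from_def by blast
      have "p \<noteq> []"
      proof
        assume "p = []"
        with p have "x = r" by (auto simp: S.apath_simps)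
        with 2 no_in show False by blast
      qed
      then obtain p0 y z where "p = p0 @ [(y, z)]"
        by (metis rev_exhaust surj_pair)
      moreover have path: "S.apath r p x" and "v \<notin> set (pawalk_verts r p)"
        using p by (auto simp: S.apath_append_iff S.apath_simps)
      ultimately have p0: "S.apath r (p0 @ [(y, x)]) x" and "y \<noteq> v"
        using S.set_awalk_verts[OF S.awalkI_apath[OF path]]
        by (auto simp: S.apath_append_iff S.apath_simps)
      with entry[OF p0 p'] show ?thesis by blast
    qed blast
  qed
  then have "unique_parents T r"
    using r(1) no_in unique by unfold_locales blast+
  then show ?thesis ..
qed

section \<open>Dominator colorings\<close>

context unique_parents
begin

abbreviation parents :: "'a set" where
  "parents \<equiv> {v \<in> verts G. out_neighborhood G v \<noteq> {}}"

lemma in_verts: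
  assumes "u \<rightarrow>\<^bsub>G\<^esub> v"
  shows "u \<in> verts G" and "v \<in> verts G"
  using assms by (auto simp: arcs_ends_conv)

lemma parent_unique:
  assumes "u \<rightarrow>\<^bsub>G\<^esub> v" and "u' \<rightarrow>\<^bsub>G\<^esub> v"
  shows "u = u'"
  using assms ex1_parent[of v] in_verts(2)[OF assms(1)] root_no_parent by metis

lemma card_parents_add_card_leaves: "card parents + card (leaves G) = card (verts G)"
proof -
  have "out_degree G v = 0 \<longleftrightarrow> out_neighborhood G v = {}" for v
    using finite_out_arcs[of v]
    by (force simp: out_degree_def out_neighborhood_def arcs_ends_conv)
  then have "verts G = parents \<union> leaves G" and "parents \<inter> leaves G = {}"
    by (auto simp: leaves_def)
  then show ?thesis
    using finite_verts card_Un_disjoint[of parents "leaves G"]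
    by (metis (no_types, lifting) finite_Un)
qed

text \<open>
  Choosing a dominated class for each parent is injective, since a vertex of a class dominated by
  two parents would have both as in-neighbors. The color of the root is never chosen.
\<close>

lemma card_colors_ge:
  assumes col: "dominator_coloring G c"
  shows "card parents + 1 \<le> card (c ` verts G)"
proof -
  have "\<forall>v\<in>parents. \<exists>i. color_class G c i \<noteq> {} \<and> color_class G c i \<subseteq> out_neighborhood G v"
    using col by (simp add: dominator_coloring_def)
  then obtain k where
    k: "\<And>v. v \<in> parents \<Longrightarrow> color_class G c (k v) \<noteq> {} \<and> color_class G c (k v) \<subseteq> out_neighborhood G v"
    using bchoice[of parents "\<lambda>v i. color_class G c i \<noteq> {} \<and> color_class G c i \<subseteq> out_neighborhood G v"]
    by blast
  have "inj_on k parents"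
  proof (rule inj_onI)
    fix u v assume "u \<in> parents" "v \<in> parents" "k u = k v"
    then obtain w where "w \<in> out_neighborhood G u" "w \<in> out_neighborhood G v"
      using k[of u] k[of v] by auto
    then show "u = v" using parent_unique by (auto simp: out_neighborhood_def)
  qed
  have "k ` parents \<subseteq> c ` verts G - {c r}"
  proof
    fix i assume "i \<in> k ` parents"
    then obtain v where v: "v \<in> parents" "i = k v" by blast
    then have "i \<in> c ` verts G"
      using k[OF v(1)] v(2) by (force simp: color_class_def)
    moreover have "i \<noteq> c r"
      using k[OF v(1)] root_in_verts root_no_parent v(2)
      by (auto simp: color_class_def out_neighborhood_def)
    ultimately show "i \<in> c ` verts G - {c r}" by blast
  qed
  then have "card (k ` parents) \<le> card (c ` verts G - {c r})"
    by (intro card_mono) auto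
  also have "\<dots> + 1 = card (c ` verts G)"
    using root_in_verts by (metis finite_verts Suc_eq_plus1 card_Suc_Diff1 finite_imageI imageI)
  finally show ?thesis
    using card_image[OF \<open>inj_on k parents\<close>] by linarith
qed

text \<open>
  Color \<open>0\<close> is reserved for the root, and the children of \<open>v\<close> receive \<open>Suc (f v)\<close>, where \<open>f\<close>
  numbers the vertices. The class of the color \<open>Suc (f v)\<close> is exactly the out-neighborhood of
  \<open>v\<close>.
\<close>

lemma parent_coloring_exists:
  "\<exists>c :: 'a \<Rightarrow> nat. dominator_coloring G c \<and> card (c ` verts G) = card parents + 1"
proof -
  obtain f :: "'a \<Rightarrow> nat" where f: "inj_on f (verts G)"
    using finite_imp_inj_to_nat_seg[OF finite_verts] by blast
  define c where "c v = (if v = r then 0 else Suc (f (THE u. u \<rightarrow>\<^bsub>G\<^esub> v)))" for v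
  have c_root: "c r = 0" by (simp add: c_def)
  have c_child: "c v = Suc (f u)" if "u \<rightarrow>\<^bsub>G\<^esub> v" for u v
  proof -
    have "(THE u. u \<rightarrow>\<^bsub>G\<^esub> v) = u" using that parent_unique by blast
    then show ?thesis using that root_no_parent by (auto simp: c_def)
  qed
  have "proper_coloring G c"
    unfolding proper_coloring_def
  proof (intro allI impI)
    fix u v assume uv: "u \<rightarrow>\<^bsub>G\<^esub> v"
    show "c u \<noteq> c v"
    proof (cases "u = r")
      case False
      then obtain w where w: "w \<rightarrow>\<^bsub>G\<^esub> u" using ex1_parent in_verts[OF uv] by blast
      then have "w \<noteq> u" using w adj_not_same by blast
      then show ?thesis
        using c_child[OF w] c_child[OF uv] inj_onD[OF f _ in_verts[OF w]] by auto
    qed (simp add: c_root c_child[OF uv])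
  qed
  moreover have "color_class G c (Suc (f v)) = out_neighborhood G v" if "v \<in> verts G" for v
  proof (intro equalityI subsetI)
    fix w assume "w \<in> color_class G c (Suc (f v))"
    then have w: "w \<in> verts G" "c w = Suc (f v)" by (auto simp: color_class_def)
    then have "w \<noteq> r" using c_root by auto
    then obtain u where u: "u \<rightarrow>\<^bsub>G\<^esub> w" using ex1_parent w(1) by blast
    then have "u = v"
      using c_child[OF u] w(2) inj_onD[OF f _ in_verts(1)[OF u] that] by simp
    then show "w \<in> out_neighborhood G v" using u by (simp add: out_neighborhood_def)
  next
    fix w assume "w \<in> out_neighborhood G v"
    then have vw: "v \<rightarrow>\<^bsub>G\<^esub> w" by (simp add: out_neighborhood_def)
    then show "w \<in> color_class G c (Suc (f v))"
      using c_child[OF vw] in_verts(2)[OF vw] by (simp add: color_class_def)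
  qed
  then have "\<exists>k. color_class G c k \<noteq> {} \<and> color_class G c k \<subseteq> out_neighborhood G v"
    if "v \<in> parents" for v
    using that by (intro exI[of _ "Suc (f v)"]) simp
  ultimately have "dominator_coloring G c"
    by (simp add: dominator_coloring_def)
  moreover have "c ` verts G = insert 0 ((Suc \<circ> f) ` parents)"
  proof (intro equalityI subsetI)
    fix i assume "i \<in> c ` verts G"
    then obtain v where v: "v \<in> verts G" "i = c v" by blast
    show "i \<in> insert 0 ((Suc \<circ> f) ` parents)"
    proof (cases "v = r")
      case False
      then obtain u where u: "u \<rightarrow>\<^bsub>G\<^esub> v" using ex1_parent v by blast
      then have "u \<in> parents" using in_verts(1)[OF u] by (auto simp: out_neighborhood_def)
      then show ?thesis using c_child[OF u] v(2) by simp
    qed (simp add: v c_root)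
  next
    fix i assume "i \<in> insert 0 ((Suc \<circ> f) ` parents)"
    then consider "i = 0" | u v where "u \<rightarrow>\<^bsub>G\<^esub> v" "i = Suc (f u)"
      by (auto simp: out_neighborhood_def)
    then show "i \<in> c ` verts G"
    proof cases
      case 1
      then show ?thesis using c_root root_in_verts by force
    next
      case 2
      then show ?thesis using c_child[OF 2(1)] in_verts(2)[OF 2(1)] by (metis imageI)
    qed
  qed
  moreover have "inj_on (Suc \<circ> f) parents"
    using f by (auto simp: inj_on_def)
  then have "card ((Suc \<circ> f) ` parents) = card parents" by (rule card_image)
  then have "card (insert 0 ((Suc \<circ> f) ` parents)) = card parents + 1"
    using finite_verts by (subst card_insert_disjoint) auto
  ultimately show ?thesis by (intro exI[of _ c]) simp
qed

lemma dominator_chromatic_number_eq: "dominator_chromatic_number G = card parents + 1"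
  unfolding dominator_chromatic_number_def
  using parent_coloring_exists card_colors_ge by (intro Least_equality) blast+

end

theorem lemma2:
  fixes T :: "('a, 'b) pre_digraph" and n l :: nat
  assumes "out_tree T"
    and "n = card (verts T)"
    and "l = card (leaves T)"
  shows "int (dominator_chromatic_number T) = int n - int l + 1"
proof -
  obtain r where "unique_parents T r"
    using out_tree_imp_unique_parents[OF assms(1)] ..
  then interpret unique_parents T r .
  show ?thesis
    using dominator_chromatic_number_eq card_parents_add_card_leaves assms(2,3) by linarith
qed

end
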